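(* For every set $K\subset\mathbb{R}^n$ that is the support of an absolutely decaying measure there exists $\alpha=\alpha(K)>0$ such that for every $M\in\operatorname{GL}_n(\mathbb{R})\cap\operatorname{M}_{n\times n}(\mathbb{Z})$ and every $y\in\mathbb{T}^n$, the set $$\tilde E(M,y)=\{\mathbf{x}\in\mathbb{R}^n:\ y\notin\overline{\{\pi(M^k\mathbf{x}):k\in\mathbb{N}\}}\}$$ is $\alpha$-winning on $K$.
   Context: $\mathbb{T}^n=\mathbb{R}^n/\mathbb{Z}^n$ and $\pi:\mathbb{R}^n\to\mathbb{T}^n$ is the quotient map. For a closed set $K\subset\mathbb{R}^n$ and $0<\alpha,\beta<1$, Schmidt's $(\alpha,\beta)$-game on $K$ with target set $S$: balls are $B(\mathbf{x},\rho)=\{\mathbf{x}'\in K: d(\mathbf{x},\mathbf{x}')\le\rho\}$ with $\mathbf{x}\in K$, $\rho>0$ ($d$ Euclidean), and $(\mathbf{x}_2,\rho_2)\le_s(\mathbf{x}_1,\rho_1)$ means $\rho_2+d(\mathbf{x}_1,\mathbf{x}_2)\le\rho_1$. Bob picks $\omega_1=(\mathbf{x}_1,\rho_1)$; then Alice and Bob alternately pick $\omega_k'=(\mathbf{x}_k',\rho_k')\le_s\omega_k$ and $\omega_{k+1}\le_s\omega_k'$, centers in $K$, with $\rho_k'=\alpha\rho_k$, $\rho_{k+1}=\beta\rho_k'$. The nested balls intersect in one point $\mathbf{x}_\infty$; Alice wins if $\mathbf{x}_\infty\in S$. $S$ is $(\alpha,\beta)$-winning on $K$ if Alice has a strategy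 guaranteeing $\mathbf{x}_\infty\in S\cap K$, and $\alpha$-winning on $K$ if this holds for every $\beta\in(0,1)$. A locally finite Borel measure $\mu$ on $\mathbb{R}^n$ is $(C,\gamma)$-absolutely decaying ($C,\gamma>0$) if there is $\rho_0>0$ with $\mu(B(\mathbf{x},\rho)\cap\mathcal L^{(\varepsilon)})<C(\varepsilon/\rho)^\gamma\mu(B(\mathbf{x},\rho))$ for every affine hyperplane $\mathcal L$, $\mathbf{x}\in\operatorname{supp}\mu$, $0<\rho<\rho_0$, $\varepsilon>0$ (closed Euclidean balls; $\mathcal L^{(\varepsilon)}$ the closed $\varepsilon$-neighborhood of $\mathcal L$); $\mu$ is absolutely decaying if it is $(C,\gamma)$-absolutely decaying for some $C,\gamma>0$. *)

theory Defs
  imports "HOL-Analysis.Analysis" "HOL-Probability.Probability"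
begin

type_synonym 'n sball = "(real^'n::finite) \<times> real"

definition Kball :: "(real^'n::finite) set \<Rightarrow> 'n sball \<Rightarrow> (real^'n) set" where
  "Kball K w = K \<inter> cball (fst w) (snd w)"

definition sle :: "('n::finite) sball \<Rightarrow> 'n sball \<Rightarrow> bool" where
  "sle w2 w1 \<longleftrightarrow> snd w2 + dist (fst w1) (fst w2) \<le> snd w1"

definition alice_move :: "(('n::finite) sball list \<Rightarrow> 'n sball) \<Rightarrow> (nat \<Rightarrow> 'n sball) \<Rightarrow> nat \<Rightarrow> 'n sball" where
  "alice_move F b k = F (map b [0..<Suc k])"

definition bob_first_legal :: "(real^'n::finite) set \<Rightarrow> 'n sball \<Rightarrow> bool" where
  "bob_first_legal K w \<longleftrightarrow> fst w \<in> K \<and> snd w > 0"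

definition alice_legal :: "(real^'n::finite) set \<Rightarrow> real \<Rightarrow> 'n sball \<Rightarrow> 'n sball \<Rightarrow> bool" where
  "alice_legal K \<alpha> w w' \<longleftrightarrow> fst w' \<in> K \<and> snd w' = \<alpha> * snd w \<and> sle w' w"

definition bob_legal :: "(real^'n::finite) set \<Rightarrow> real \<Rightarrow> 'n sball \<Rightarrow> 'n sball \<Rightarrow> bool" where
  "bob_legal K \<beta> w' w \<longleftrightarrow> fst w \<in> K \<and> snd w = \<beta> * snd w' \<and> sle w w'"

definition bob_legal_upto ::
  "(real^'n::finite) set \<Rightarrow> real \<Rightarrow> ('n sball list \<Rightarrow> 'n sball) \<Rightarrow> (nat \<Rightarrow> 'n sball) \<Rightarrow> nat \<Rightarrow> bool" where
  "bob_legal_upto K \<beta> F b k \<longleftrightarrow>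
     bob_first_legal K (b 0) \<and> (\<forall>j<k. bob_legal K \<beta> (alice_move F b j) (b (Suc j)))"

text \<open>Schmidt's (alpha,beta)-game on K with target S: Alice has a strategy that always
  produces legal moves against legal play of Bob, and such that the point of intersection
  of the nested balls lies in S (it lies in K automatically).\<close>
definition ab_winning :: "(real^'n::finite) set \<Rightarrow> real \<Rightarrow> real \<Rightarrow> (real^'n) set \<Rightarrow> bool" where
  "ab_winning K \<alpha> \<beta> S \<longleftrightarrow>
     (\<exists>F. (\<forall>b k. bob_legal_upto K \<beta> F b k \<longrightarrow> alice_legal K \<alpha> (b k) (alice_move F b k)) \<and>
          (\<forall>b. (\<forall>k. bob_legal_upto K \<beta> F b k) \<longrightarrow>
               (\<forall>x. (\<forall>k. x \<in> Kball K (b k)) \<longrightarrow> x \<in> S)))"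

definition alpha_winning :: "(real^'n::finite) set \<Rightarrow> real \<Rightarrow> (real^'n) set \<Rightarrow> bool" where
  "alpha_winning K \<alpha> S \<longleftrightarrow> (\<forall>\<beta>. 0 < \<beta> \<and> \<beta> < 1 \<longrightarrow> ab_winning K \<alpha> \<beta> S)"

definition locally_finite_borel :: "(real^'n::finite) measure \<Rightarrow> bool" where
  "locally_finite_borel \<mu> \<longleftrightarrow> sets \<mu> = sets borel \<and>
     (\<forall>x. \<exists>U. open U \<and> x \<in> U \<and> emeasure \<mu> U < \<infinity>)"

definition msupp :: "(real^'n::finite) measure \<Rightarrow> (real^'n) set" where
  "msupp \<mu> = {x. \<forall>r>0. emeasure \<mu> (ball x r) > 0}"

definition affine_hyperplane :: "(real^'n::finite) set \<Rightarrow> bool" where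
  "affine_hyperplane L \<longleftrightarrow> (\<exists>a b. a \<noteq> 0 \<and> L = {y. a \<bullet> y = b})"

definition nbhd :: "(real^'n::finite) set \<Rightarrow> real \<Rightarrow> (real^'n) set" where
  "nbhd L \<epsilon> = {y. infdist y L \<le> \<epsilon>}"

definition abs_decaying_with :: "(real^'n::finite) measure \<Rightarrow> real \<Rightarrow> real \<Rightarrow> bool" where
  "abs_decaying_with \<mu> C \<gamma> \<longleftrightarrow> locally_finite_borel \<mu> \<and> C > 0 \<and> \<gamma> > 0 \<and>
     (\<exists>\<rho>0>0. \<forall>L x \<rho> \<epsilon>. affine_hyperplane L \<and> x \<in> msupp \<mu> \<and> 0 < \<rho> \<and> \<rho> < \<rho>0 \<and> \<epsilon> > 0 \<longrightarrow>
        measure \<mu> (cball x \<rho> \<inter> nbhd L \<epsilon>) < C * (\<epsilon> / \<rho>) powr \<gamma> * measure \<mu> (cball x \<rho>))"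

definition abs_decaying :: "(real^'n::finite) measure \<Rightarrow> bool" where
  "abs_decaying \<mu> \<longleftrightarrow> (\<exists>C \<gamma>. abs_decaying_with \<mu> C \<gamma>)"

text \<open>Torus: a point y of T^n is represented by any lift yl in R^n; pi(v) is represented by v.
  The preimage under pi of the closure of pi(S) is the closure of S + Z^n.\<close>
definition int_vectors :: "(real^'n::finite) set" where
  "int_vectors = {m. \<forall>i. m $ i \<in> \<int>}"

definition torus_closure_lift :: "(real^'n::finite) set \<Rightarrow> (real^'n) set" where
  "torus_closure_lift S = closure {s + m | s m. s \<in> S \<and> m \<in> int_vectors}"

definition integer_matrix :: "real^'n::finite^'n \<Rightarrow> bool" where
  "integer_matrix M \<longleftrightarrow> (\<forall>i j. M $ i $ j \<in> \<int>)"

definition Etilde :: "real^'n::finite^'n \<Rightarrow> real^'n \<Rightarrow> (real^'n) set" where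
  "Etilde M yl = {x. yl \<notin> torus_closure_lift {((\<lambda>v. M *v v) ^^ k) x | k. True}}"

end

theory Submission
  imports Defs "HOL-Computational_Algebra.Fundamental_Theorem_Algebra"
begin

text \<open>
  For an integer vector \<open>v\<close> put \<open>t\<^sub>k = (M\<^sup>T)\<^sup>k v\<close>. Since \<open>v \<bullet> m \<in> \<int>\<close> for integral \<open>m\<close>, the orbit of \<open>x\<close>
  stays away from \<open>y + \<int>\<^sup>n\<close> as soon as the numbers \<open>t\<^sub>k \<bullet> x - v \<bullet> y\<close> stay uniformly away from \<open>\<int>\<close>.
  If \<open>v\<close> is chosen with an annihilating polynomial of minimal degree, this polynomial has distinct complex
  roots and \<open>|t\<^sub>k|\<close> is comparable to \<open>R\<^sup>k\<close> for some \<open>R\<close>: either the \<open>t\<^sub>k\<close> form a finite set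
  (\<open>R \<le> 1\<close>) or their norms grow geometrically. Hence each round of the game
  confronts Alice with a bounded number of new hyperplane neighbourhoods of width proportional to the
  radius. By the decay condition some point of \<open>K\<close> lies close to at most a quarter of
  the hyperplanes, counted with weights; doubling the weight of a hyperplane in each round in which it is
  not avoided keeps the total weight bounded, so every hyperplane is avoided within boundedly many rounds.
  The constant \<open>\<alpha>\<close> only enters through the averaging step and depends on the measure alone.
\<close>

section \<open>Avoiding hyperplanes on the support of a decaying measure\<close>

text \<open>The complement of the support is a union of null balls, and by Lindelof countably many
  of them already cover it.\<close>

lemma AE_msupp:
  fixes \<mu> :: "(real^'n::finite) measure"
  assumes "sets \<mu> = sets borel"
  shows "AE x in \<mu>. x \<in> msupp \<mu>"
proof -
  define \<F> where "\<F> = {ball x r | x r. emeasure \<mu> (ball x r) = 0}"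
  obtain \<F>' where F: "\<F>' \<subseteq> \<F>" "countable \<F>'" "\<Union>\<F>' = \<Union>\<F>"
    using Lindelof[of \<F>] by (auto simp: \<F>_def)
  have "\<Union>\<F>' \<in> null_sets \<mu>"
    using F(1,2) by (intro null_sets_UN'[of \<F>' "\<lambda>x. x", simplified])
      (auto simp: \<F>_def null_sets_def assms)
  moreover have "{x \<in> space \<mu>. x \<notin> msupp \<mu>} \<subseteq> \<Union>\<F>'"
  proof
    fix x assume "x \<in> {x \<in> space \<mu>. x \<notin> msupp \<mu>}"
    then obtain r where "r > 0" "emeasure \<mu> (ball x r) = 0"
      by (auto simp: msupp_def)
    then have "ball x r \<in> \<F>" "x \<in> ball x r" by (auto simp: \<F>_def)
    then show "x \<in> \<Union>\<F>'" using F(3) by blast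
  qed
  ultimately show ?thesis by (rule AE_I')
qed

lemma emeasure_compact_finite:
  assumes "locally_finite_borel \<mu>" "compact S"
  shows "emeasure \<mu> S < \<infinity>"
proof -
  have sets: "sets \<mu> = sets borel" using assms(1) by (simp add: locally_finite_borel_def)
  obtain U where U: "\<And>x. open (U x)" "\<And>x. x \<in> U x" "\<And>x. emeasure \<mu> (U x) < \<infinity>"
    using assms(1) unfolding locally_finite_borel_def by metis
  obtain C where C: "C \<subseteq> S" "finite C" "S \<subseteq> (\<Union>x\<in>C. U x)"
    using compactE_image[OF assms(2), of S U] U by blast
  have "emeasure \<mu> S \<le> emeasure \<mu> (\<Union>x\<in>C. U x)"
    using C U sets by (intro emeasure_mono) auto
  also have "\<dots> \<le> (\<Sum>x\<in>C. emeasure \<mu> (U x))"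
    using C U sets by (intro emeasure_subadditive_finite) auto
  also have "\<dots> < \<infinity>" using C(2) U(3) by (simp add: less_top)
  finally show ?thesis .
qed

lemma infdist_hyperplane_le:
  fixes a y :: "real^'n::finite"
  assumes "a \<noteq> 0" "\<bar>a \<bullet> y - d\<bar> \<le> e * norm a"
  shows "infdist y {z. a \<bullet> z = d} \<le> e"
proof -
  define z where "z = y - ((a \<bullet> y - d) / (a \<bullet> a)) *\<^sub>R a"
  have "a \<bullet> z = d" using assms(1) by (simp add: z_def inner_diff_right)
  then have "infdist y {z. a \<bullet> z = d} \<le> dist y z" by (intro infdist_le) auto
  also have "dist y z = \<bar>a \<bullet> y - d\<bar> / (a \<bullet> a) * norm a"
    by (simp add: z_def dist_norm)
  also have "\<dots> = \<bar>a \<bullet> y - d\<bar> / norm a"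
    using assms(1) by (simp add: dot_square_norm power2_eq_square)
  also have "\<dots> \<le> e" using assms by (simp add: divide_le_eq)
  finally show ?thesis .
qed

text \<open>Averaging: each neighbourhood fills at most an eighth of a ball, so the mean weight of
  the hyperplanes close to a point is at most an eighth of the total. The factor
  \<open>1 - \<alpha>\<close> leaves room for a ball of radius \<open>\<alpha> * \<rho>\<close>
  around \<open>y\<close> inside Bob's ball.\<close>

lemma abs_decaying_avoid_hyperplanes:
  fixes \<mu> :: "(real^'n::finite) measure"
  assumes "abs_decaying \<mu>"
  obtains \<alpha> \<rho>\<^sub>0 where "0 < \<alpha>" "\<alpha> < 1" "0 < \<rho>\<^sub>0"
    "\<And>(I :: 'i set) (w :: 'i \<Rightarrow> real) a d x \<rho>. \<lbrakk>finite I; \<And>i. i \<in> I \<Longrightarrow> 0 \<le> w i; \<And>i. i \<in> I \<Longrightarrow> a i \<noteq> 0;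
        x \<in> msupp \<mu>; 0 < \<rho>; \<rho> < \<rho>\<^sub>0\<rbrakk> \<Longrightarrow>
      \<exists>y\<in>msupp \<mu>. dist x y \<le> (1 - \<alpha>) * \<rho> \<and>
        (\<Sum>i | i \<in> I \<and> \<bar>a i \<bullet> y - d i\<bar> \<le> 2 * \<alpha> * \<rho> * norm (a i). w i) \<le> (\<Sum>i\<in>I. w i) / 4"
proof -
  obtain C \<gamma> \<rho>\<^sub>0 where lf: "locally_finite_borel \<mu>" and pos: "C > 0" "\<gamma> > 0" "\<rho>\<^sub>0 > 0"
    and decay: "\<And>L x \<rho> \<epsilon>. \<lbrakk>affine_hyperplane L; x \<in> msupp \<mu>; 0 < \<rho>; \<rho> < \<rho>\<^sub>0; \<epsilon> > 0\<rbrakk> \<Longrightarrow>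
        measure \<mu> (cball x \<rho> \<inter> nbhd L \<epsilon>) < C * (\<epsilon> / \<rho>) powr \<gamma> * measure \<mu> (cball x \<rho>)"
    using assms unfolding abs_decaying_def abs_decaying_with_def by metis
  have sets[measurable_cong]: "sets \<mu> = sets borel" using lf by (simp add: locally_finite_borel_def)
  \<comment> \<open>The bound 1/2 gives
    \<open>2 * \<alpha> / (1 - \<alpha>) \<le> 4 * \<alpha>\<close>; the other term then makes the
    decay factor at most 1/8.\<close>
  define \<alpha> where "\<alpha> = min (1/2) ((1 / (8 * C)) powr (1 / \<gamma>) / 4)"
  have \<alpha>: "0 < \<alpha>" "\<alpha> \<le> 1/2" "\<alpha> \<le> (1 / (8 * C)) powr (1 / \<gamma>) / 4"
    using pos by (auto simp: \<alpha>_def)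
  have small: "C * (2 * \<alpha> / (1 - \<alpha>)) powr \<gamma> \<le> 1/8"
  proof -
    have "2 * \<alpha> / (1 - \<alpha>) \<le> 4 * \<alpha>" using \<alpha> by (simp add: divide_le_eq algebra_simps)
    also have "\<dots> \<le> (1 / (8 * C)) powr (1 / \<gamma>)" using \<alpha>(3) by simp
    finally have "(2 * \<alpha> / (1 - \<alpha>)) powr \<gamma> \<le> ((1 / (8 * C)) powr (1 / \<gamma>)) powr \<gamma>"
      using \<alpha> pos by (intro powr_mono2) auto
    also have "\<dots> = 1 / (8 * C)" using pos by (simp add: powr_powr)
    finally show ?thesis using pos by (simp add: field_simps)
  qed
  show thesis
  proof (rule that[of \<alpha> \<rho>\<^sub>0])
    show "0 < \<alpha>" "\<alpha> < 1" "0 < \<rho>\<^sub>0" using \<alpha> pos by auto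
    fix I :: "'i set" and w :: "'i \<Rightarrow> real" and a :: "'i \<Rightarrow> real^'n" and d :: "'i \<Rightarrow> real" and x \<rho>
    assume I: "finite I" and w: "\<And>i. i \<in> I \<Longrightarrow> 0 \<le> w i" and a: "\<And>i. i \<in> I \<Longrightarrow> a i \<noteq> 0"
      and x: "x \<in> msupp \<mu>" and \<rho>: "0 < \<rho>" "\<rho> < \<rho>\<^sub>0"
    define B where "B = cball x ((1 - \<alpha>) * \<rho>)"
    define A where "A i = {y. \<bar>a i \<bullet> y - d i\<bar> \<le> 2 * \<alpha> * \<rho> * norm (a i)}" for i
    define f where "f y = (\<Sum>i\<in>I. w i * indicator (A i) y)" for y
    define W where "W = (\<Sum>i\<in>I. w i)"
    have r: "0 < (1 - \<alpha>) * \<rho>" "(1 - \<alpha>) * \<rho> < \<rho>\<^sub>0" 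
      using \<alpha> \<rho> by (auto intro: le_less_trans[OF mult_left_le_one_le])
    have Bfin: "emeasure \<mu> B < \<infinity>" 
      unfolding B_def by (intro emeasure_compact_finite lf compact_cball)
    have clA: "closed (A i)" for i
      unfolding A_def by (intro closed_Collect_le continuous_intros)
    have meas[measurable]: "A i \<in> sets borel" "B \<in> sets borel" for i
      using clA by (auto simp: B_def)
    have Bfm: "B \<in> fmeasurable \<mu>" using Bfin by (intro fmeasurableI) (auto simp: sets)
    have "0 < emeasure \<mu> (ball x ((1 - \<alpha>) * \<rho>))" using x r by (simp add: msupp_def)
    also have "\<dots> \<le> emeasure \<mu> B" unfolding B_def by (intro emeasure_mono) (auto simp: sets)
    finally have Bpos: "0 < measure \<mu> B"
      using Bfin by (simp add: measure_def enn2real_positive_iff less_top)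
    have Ale: "measure \<mu> (B \<inter> A i) \<le> measure \<mu> B / 8" if i: "i \<in> I" for i
    proof -
      define L where "L = {z. a i \<bullet> z = d i}"
      have "closed (nbhd L (2 * \<alpha> * \<rho>))"
        unfolding nbhd_def by (intro closed_Collect_le continuous_intros)
      then have N: "nbhd L (2 * \<alpha> * \<rho>) \<in> sets \<mu>" by (simp add: sets)
      have "A i \<subseteq> nbhd L (2 * \<alpha> * \<rho>)"
        using infdist_hyperplane_le[OF a[OF i]] by (auto simp: A_def nbhd_def L_def)
      then have "measure \<mu> (B \<inter> A i) \<le> measure \<mu> (B \<inter> nbhd L (2 * \<alpha> * \<rho>))"
        using fmeasurable_Int_fmeasurable[OF Bfm N] by (intro measure_mono_fmeasurable) (auto simp: sets)
      also have "\<dots> \<le> C * (2 * \<alpha> * \<rho> / ((1 - \<alpha>) * \<rho>)) powr \<gamma> * measure \<mu> B"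
        unfolding B_def using a[OF i] x r \<alpha> \<rho>
        by (intro less_imp_le decay) (auto simp: affine_hyperplane_def L_def)
      also have "2 * \<alpha> * \<rho> / ((1 - \<alpha>) * \<rho>) = 2 * \<alpha> / (1 - \<alpha>)" using \<rho> by simp
      also have "C * \<dots> powr \<gamma> * measure \<mu> B \<le> 1/8 * measure \<mu> B"
        using small by (intro mult_right_mono) auto
      finally show ?thesis by simp
    qed
    \<comment> \<open>If every support point of \<open>B\<close> had \<open>f y > W / 4\<close>,
      integrating over \<open>B\<close> would give \<open>W / 4 \<le> W / 8\<close>. This forces
      \<open>W = 0\<close>, all weights vanish, and then the centre \<open>x\<close> itself refutes
      the assumption.\<close>
    have "\<exists>y\<in>msupp \<mu>. y \<in> B \<and> f y \<le> W / 4"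
    proof (rule ccontr)
      assume neg: "\<not> ?thesis"
      have W0: "0 \<le> W" unfolding W_def by (intro sum_nonneg w)
      have int: "integrable \<mu> (\<lambda>y. indicator (B \<inter> A i) y :: real)" for i
        using Bfin by (intro integrable_real_indicator)
          (auto simp: sets intro: le_less_trans[OF emeasure_mono])
      have "W / 4 * measure \<mu> B = (\<integral>y. W / 4 * indicator B y \<partial>\<mu>)" 
        using Bfin by (simp add: sets)
      also have "\<dots> \<le> (\<integral>y. (\<Sum>i\<in>I. w i * indicator (B \<inter> A i) y) \<partial>\<mu>)"
      proof (rule integral_mono_AE)
        show "integrable \<mu> (\<lambda>y. W / 4 * indicator B y)"
          using Bfin by (intro integrable_mult_right integrable_real_indicator) (auto simp: sets)
        show "integrable \<mu> (\<lambda>y. \<Sum>i\<in>I. w i * indicator (B \<inter> A i) y)"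
          by (intro Bochner_Integration.integrable_sum integrable_mult_right int)
        show "AE y in \<mu>. W / 4 * indicator B y \<le> (\<Sum>i\<in>I. w i * indicator (B \<inter> A i) y)"
          using AE_msupp[OF sets]
        proof eventually_elim
          case (elim y)
          have "y \<in> B \<Longrightarrow> W / 4 < f y" using neg elim by (auto simp: not_le)
          then show ?case by (cases "y \<in> B") (auto simp: f_def indicator_inter_arith)
        qed
      qed
      also have "\<dots> = (\<Sum>i\<in>I. w i * measure \<mu> (B \<inter> A i))"
        using int by (subst Bochner_Integration.integral_sum) (auto simp: sets)
      also have "\<dots> \<le> (\<Sum>i\<in>I. w i * (measure \<mu> B / 8))"
        by (intro sum_mono mult_left_mono Ale w)
      also have "\<dots> = W / 8 * measure \<mu> B" by (simp add: W_def sum_distrib_right sum_divide_distrib)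
      finally have "W / 4 \<le> W / 8" using Bpos by (simp only: mult_le_cancel_right_pos)
      then have "W = 0" using W0 by simp
      then have "\<forall>i\<in>I. w i = 0" using w I by (simp add: W_def sum_nonneg_eq_0_iff)
      then have "f x \<le> W / 4" using \<open>W = 0\<close> by (simp add: f_def)
      then show False using neg x r by (auto simp: B_def)
    qed
    then obtain y where y: "y \<in> msupp \<mu>" "y \<in> B" "f y \<le> W / 4" by blast
    have "f y = (\<Sum>i | i \<in> I \<and> \<bar>a i \<bullet> y - d i\<bar> \<le> 2 * \<alpha> * \<rho> * norm (a i). w i)"
      unfolding f_def using I
      by (intro sum.mono_neutral_cong_right) (auto simp: A_def indicator_def)
    then show "\<exists>y\<in>msupp \<mu>. dist x y \<le> (1 - \<alpha>) * \<rho> \<and>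
        (\<Sum>i | i \<in> I \<and> \<bar>a i \<bullet> y - d i\<bar> \<le> 2 * \<alpha> * \<rho> * norm (a i). w i) \<le> (\<Sum>i\<in>I. w i) / 4"
      using y by (intro bexI[of _ y]) (auto simp: B_def W_def)
  qed
qed

section \<open>Winning against a lacunary family of functionals\<close>

text \<open>A strategy is a function of finite histories, whereas \<open>P\<close> describes good
  answers to a whole sequence of Bob's balls. By \<open>past\<close> only the balls up to round
  \<open>k\<close> matter, so an answer chosen from the history list is good for every
  continuation.\<close>

lemma ab_winningI:
  fixes K :: "(real^'n::finite) set" and P :: "(nat \<Rightarrow> 'n sball) \<Rightarrow> nat \<Rightarrow> 'n sball \<Rightarrow> bool"
  assumes \<alpha>\<beta>: "0 < \<alpha>" "0 < \<beta>"
    and past: "\<And>b b' k w. (\<And>i. i \<le> k \<Longrightarrow> b i = b' i) \<Longrightarrow> P b k w \<Longrightarrow> P b' k w"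
    and ex: "\<And>b k. fst (b k) \<in> K \<Longrightarrow> (\<And>i. i \<le> k \<Longrightarrow> 0 < snd (b i)) \<Longrightarrow> \<exists>w. alice_legal K \<alpha> (b k) w \<and> P b k w"
    and win: "\<And>a b x. \<lbrakk>0 < snd (b 0); \<And>k. alice_legal K \<alpha> (b k) (a k); \<And>k. P b k (a k);
      \<And>k. bob_legal K \<beta> (a k) (b (Suc k)); \<And>k. x \<in> cball (fst (b k)) (snd (b k))\<rbrakk> \<Longrightarrow> x \<in> S"
  shows "ab_winning K \<alpha> \<beta> S"
proof -
  \<comment> \<open>A history of \<open>k + 1\<close> balls asks for Alice's move in round
    \<open>k\<close>, hence \<open>length h - 1\<close>.\<close>
  define F where "F h = (SOME w. alice_legal K \<alpha> (last h) w \<and> P (\<lambda>i. h ! i) (length h - 1) w)" for h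
  have move: "alice_legal K \<alpha> (b k) (alice_move F b k) \<and> P b k (alice_move F b k)"
    if "fst (b k) \<in> K" "\<And>i. i \<le> k \<Longrightarrow> 0 < snd (b i)" for b k
  proof -
    have nth: "map b [0..<Suc k] ! i = b i" if "i \<le> k" for i
      using that by (simp del: upt_Suc)
    have "P (\<lambda>i. map b [0..<Suc k] ! i) k w \<longleftrightarrow> P b k w" for w
      using past[of k "\<lambda>i. map b [0..<Suc k] ! i" b w] past[of k b "\<lambda>i. map b [0..<Suc k] ! i" w] nth
      by metis
    then have "alice_move F b k = (SOME w. alice_legal K \<alpha> (b k) w \<and> P b k w)"
      by (simp add: alice_move_def F_def)
    then show ?thesis using someI_ex[OF ex[of b k, OF that]] by simp
  qed
  have ball: "fst (b k) \<in> K \<and> (\<forall>i\<le>k. 0 < snd (b i))" if "bob_legal_upto K \<beta> F b k" for b k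
    using that
  proof (induction k)
    case 0
    then show ?case by (simp add: bob_legal_upto_def bob_first_legal_def)
  next
    case (Suc k)
    then have IH: "fst (b k) \<in> K \<and> (\<forall>i\<le>k. 0 < snd (b i))" by (simp add: bob_legal_upto_def)
    moreover have "bob_legal K \<beta> (alice_move F b k) (b (Suc k))"
      using Suc.prems by (simp add: bob_legal_upto_def)
    ultimately show ?case using move[of b k] \<alpha>\<beta>
      by (auto simp: alice_legal_def bob_legal_def le_Suc_eq)
  qed
  show ?thesis unfolding ab_winning_def
  proof (intro exI[of _ F] conjI allI impI)
    show "alice_legal K \<alpha> (b k) (alice_move F b k)" if "bob_legal_upto K \<beta> F b k" for b k
      using ball[OF that] move by blast
    show "x \<in> S" if "\<forall>k. bob_legal_upto K \<beta> F b k" "\<forall>k. x \<in> Kball K (b k)" for b x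
    proof (rule win[of b "alice_move F b"])
      show "0 < snd (b 0)" using that(1) ball by blast
      show "alice_legal K \<alpha> (b k) (alice_move F b k)" "P b k (alice_move F b k)" for k
        using that(1) ball move by blast+
      show "bob_legal K \<beta> (alice_move F b k) (b (Suc k))" for k
        using that(1) unfolding bob_legal_upto_def by blast
      show "x \<in> cball (fst (b k)) (snd (b k))" for k
        using that(2) by (simp add: Kball_def)
    qed
  qed
qed

text \<open>Set version of a lacunary sequence: no ordering is required, and finite sets of vectors
  of norm at least 1 qualify. The lower bound 1 later keeps the distance to the hyperplanes away
  from 0.\<close>

definition lacunary_set :: "(real^'n::finite) set \<Rightarrow> bool" where
  "lacunary_set T \<longleftrightarrow> (\<forall>t\<in>T. 1 \<le> norm t) \<and>
     (\<forall>H. \<exists>N. \<forall>A>0. finite {t \<in> T. A \<le> norm t \<and> norm t < A * H} \<and>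
        card {t \<in> T. A \<le> norm t \<and> norm t < A * H} \<le> N)"

lemma lacunary_set_finite_norm_le:
  assumes "lacunary_set T"
  shows "finite {t \<in> T. norm t \<le> B}"
proof -
  have "{t \<in> T. norm t \<le> B} \<subseteq> {t \<in> T. 1 \<le> norm t \<and> norm t < 1 * (B + 1)}"
    using assms by (auto simp: lacunary_set_def)
  moreover have "finite {t \<in> T. 1 \<le> norm t \<and> norm t < 1 * (B + 1)}"
    using assms unfolding lacunary_set_def by (metis zero_less_one)
  ultimately show ?thesis by (rule finite_subset)
qed

text \<open>\<open>2 * N\<close> is the fixed point of \<open>w / 2 + N\<close>; the sum of the
  first values pays for the indices up to \<open>k0\<close>.\<close>

lemma halving_sequence_bounded:
  fixes W :: "nat \<Rightarrow> real"
  assumes "\<And>k. k \<ge> k0 \<Longrightarrow> W (Suc k) \<le> W k / 2 + N" "\<And>k. 0 \<le> W k" "0 \<le> N"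
  obtains B where "\<And>k. W k \<le> B"
proof (rule that[of "(\<Sum>i\<le>k0. W i) + 2 * N"])
  fix k
  have le: "W j \<le> (\<Sum>i\<le>k0. W i) + 2 * N" if "j \<le> k0" for j
    using member_le_sum[of j "{..k0}" W] that assms by auto
  show "W k \<le> (\<Sum>i\<le>k0. W i) + 2 * N"
  proof (cases "k \<le> k0")
    case False
    then have "k0 \<le> k" by simp
    then show ?thesis
    proof (induction k rule: dec_induct)
      case (step n)
      have "0 \<le> (\<Sum>i\<le>k0. W i)" by (intro sum_nonneg assms)
      then show ?case using step assms(1)[of n] by simp
    qed (use le in auto)
  qed (use le in auto)
qed

text \<open>\<open>\<alpha>\<close> is tied to \<open>avoid\<close>, which mentions neither
  \<open>T\<close> nor \<open>s\<close> nor \<open>\<beta>\<close>; only the final distance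
  \<open>c\<close> depends on these and on the play. Hyperplanes are indexed by pairs of an
  activation round and a functional.\<close>

theorem lacunary_set_winning:
  fixes K :: "(real^'n::finite) set" and s :: real
  assumes \<alpha>: "0 < \<alpha>" "\<alpha> < 1" and \<rho>\<^sub>0: "0 < \<rho>\<^sub>0"
    and avoid: "\<And>(I :: (nat \<times> (real^'n)) set) (w :: nat \<times> (real^'n) \<Rightarrow> real) a d x \<rho>.
      \<lbrakk>finite I; \<And>i. i \<in> I \<Longrightarrow> 0 \<le> w i; \<And>i. i \<in> I \<Longrightarrow> a i \<noteq> 0; x \<in> K; 0 < \<rho>; \<rho> < \<rho>\<^sub>0\<rbrakk> \<Longrightarrow>
      \<exists>y\<in>K. dist x y \<le> (1 - \<alpha>) * \<rho> \<and>
        (\<Sum>i | i \<in> I \<and> \<bar>a i \<bullet> y - d i\<bar> \<le> 2 * \<alpha> * \<rho> * norm (a i). w i) \<le> (\<Sum>i\<in>I. w i) / 4"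
    and T: "lacunary_set T"
  shows "alpha_winning K \<alpha> {x. \<exists>c>0. \<forall>t\<in>T. \<forall>m::int. c \<le> \<bar>t \<bullet> x - s - m\<bar>}"
  unfolding alpha_winning_def
proof (intro allI impI)
  fix \<beta> :: real assume \<beta>: "0 < \<beta> \<and> \<beta> < 1"
  have Tne: "t \<noteq> 0" and T1: "1 \<le> norm t" if "t \<in> T" for t
    using T that by (auto simp: lacunary_set_def)
  \<comment> \<open>\<open>act b j\<close>: the functionals that vary by at most \<open>1/2\<close> on Bob's ball for the first time in round \<open>j\<close>,
    so that only the integer nearest to the value at the centre can cause trouble later.\<close>
  define act where "act b j = {t \<in> T. 4 * norm t * snd (b j) \<le> 1 \<and>
      (j > 0 \<longrightarrow> 1 < 4 * norm t * snd (b (j - 1)))}" for b :: "nat \<Rightarrow> 'n sball" and j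
  define off where "off b p = s + of_int (round (snd p \<bullet> fst (b (fst p)) - s))"
    for b :: "nat \<Rightarrow> 'n sball" and p :: "nat \<times> (real^'n)"
  \<comment> \<open>Danger is read off Bob's balls alone, so the strategy needs no memory of Alice's own moves.\<close>
  define dng where "dng b p i \<longleftrightarrow> \<bar>snd p \<bullet> fst (b i) - off b p\<bar> \<le> 2 * norm (snd p) * snd (b i)"
    for b :: "nat \<Rightarrow> 'n sball" and p i
  \<comment> \<open>\<open>D\<close> collects the hyperplanes in danger in every round since their
    activation. The exponent in \<open>wt\<close> is their age, so surviving is what doubles a
    weight.\<close>
  define D where "D b i = {p. fst p \<le> i \<and> snd p \<in> act b (fst p) \<and> (\<forall>l\<in>{fst p..i}. dng b p l)}" for b i
  define wt :: "nat \<Rightarrow> nat \<times> (real^'n) \<Rightarrow> real" where "wt i p = 2 ^ (i - fst p)" for i p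
  define near where "near b i w = {p. p \<in> D b i \<and>
      \<bar>snd p \<bullet> fst w - off b p\<bar> \<le> 2 * \<alpha> * snd (b i) * norm (snd p)}" for b i and w :: "'n sball"
  \<comment> \<open>Decay is only known below scale \<open>\<rho>\<^sub>0\<close>, so nothing is
    asked of Alice in the finitely many early rounds with larger balls.\<close>
  define P where "P b i w \<longleftrightarrow> (snd (b i) < \<rho>\<^sub>0 \<longrightarrow> sum (wt i) (near b i w) \<le> sum (wt i) (D b i) / 4)" for b i w
  have finact: "finite (act b j)" if "0 < snd (b j)" for b j
    by (rule finite_subset[OF _ lacunary_set_finite_norm_le[OF T, of "1 / (4 * snd (b j))"]])
      (use that in \<open>auto simp: act_def field_simps\<close>)
  have finD: "finite (D b i)" if "\<And>j. j \<le> i \<Longrightarrow> 0 < snd (b j)" for b i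
  proof (rule finite_subset)
    show "D b i \<subseteq> (SIGMA j:{..i}. act b j)" by (auto simp: D_def)
    show "finite (SIGMA j:{..i}. act b j)" using that finact by blast
  qed
  show "ab_winning K \<alpha> \<beta> {x. \<exists>c>0. \<forall>t\<in>T. \<forall>m::int. c \<le> \<bar>t \<bullet> x - s - m\<bar>}"
  proof (rule ab_winningI[where P = P])
    show "0 < \<alpha>" "0 < \<beta>" using \<alpha> \<beta> by auto
  next
    fix b b' :: "nat \<Rightarrow> 'n sball" and k w assume eq: "\<And>i. i \<le> k \<Longrightarrow> b i = b' i" and P: "P b k w"
    have off: "off b p = off b' p" if "fst p \<le> k" for p using eq that by (simp add: off_def)
    have "D b k = D b' k"
      unfolding D_def by (intro Collect_cong) (auto simp: dng_def act_def eq off)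
    moreover from this have "near b k w = near b' k w"
      unfolding near_def by (intro Collect_cong) (auto simp: eq off D_def)
    ultimately show "P b' k w" using P eq[of k] by (simp add: P_def)
  next
    fix b :: "nat \<Rightarrow> 'n sball" and k assume b: "fst (b k) \<in> K" "\<And>i. i \<le> k \<Longrightarrow> 0 < snd (b i)"
    show "\<exists>w. alice_legal K \<alpha> (b k) w \<and> P b k w"
    proof (cases "snd (b k) < \<rho>\<^sub>0")
      case False
      have "alice_legal K \<alpha> (b k) (fst (b k), \<alpha> * snd (b k))"
        using b(1) b(2)[of k] \<alpha> by (simp add: alice_legal_def sle_def)
      then show ?thesis using False by (auto simp: P_def)
    next
      case True
      have "\<exists>y\<in>K. dist (fst (b k)) y \<le> (1 - \<alpha>) * snd (b k) \<and>
          (\<Sum>p | p \<in> D b k \<and> \<bar>snd p \<bullet> y - off b p\<bar> \<le> 2 * \<alpha> * snd (b k) * norm (snd p). wt k p)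
            \<le> (\<Sum>p\<in>D b k. wt k p) / 4"
        by (rule avoid) (use b True finD in \<open>auto simp: wt_def D_def act_def Tne\<close>)
      then obtain y where y: "y \<in> K" "dist (fst (b k)) y \<le> (1 - \<alpha>) * snd (b k)"
          "(\<Sum>p | p \<in> D b k \<and> \<bar>snd p \<bullet> y - off b p\<bar> \<le> 2 * \<alpha> * snd (b k) * norm (snd p). wt k p)
            \<le> (\<Sum>p\<in>D b k. wt k p) / 4" by blast
      then show ?thesis
        by (intro exI[of _ "(y, \<alpha> * snd (b k))"])
          (auto simp: alice_legal_def sle_def P_def near_def algebra_simps)
    qed
  next
    fix a b :: "nat \<Rightarrow> 'n sball" and x
    assume b0: "0 < snd (b 0)" and alice: "\<And>k. alice_legal K \<alpha> (b k) (a k)" and P: "\<And>k. P b k (a k)"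
      and bob: "\<And>k. bob_legal K \<beta> (a k) (b (Suc k))" and x: "\<And>k. x \<in> cball (fst (b k)) (snd (b k))"
    define q where "q = \<alpha> * \<beta>"
    have q: "0 < q" "q < 1" using \<alpha> \<beta> mult_strict_mono[of \<alpha> 1 \<beta> 1] by (auto simp: q_def)
    have Suc_rad: "snd (b (Suc k)) = q * snd (b k)" for k
      using alice[of k] bob[of k] by (simp add: alice_legal_def bob_legal_def q_def)
    have rad: "snd (b (i + k)) = q ^ i * snd (b k)" for i k
      by (induction i) (simp_all add: Suc_rad)
    have pos: "0 < snd (b k)" for k
      using rad[of k 0] b0 q by simp
    have tend: "(\<lambda>k. snd (b k)) \<longlonglongrightarrow> 0"
    proof -
      have "(\<lambda>k. q ^ k * snd (b 0)) \<longlonglongrightarrow> 0"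
        using q by (intro tendsto_mult_left_zero LIMSEQ_power_zero) auto
      moreover have "(\<lambda>k. snd (b k)) = (\<lambda>k. q ^ k * snd (b 0))"
        using rad[of _ 0] by (intro ext) (metis add_0_right)
      ultimately show ?thesis by simp
    qed
    obtain k0 where k0: "\<And>k. k \<ge> k0 \<Longrightarrow> snd (b k) < \<rho>\<^sub>0"
      using order_tendstoD(2)[OF tend \<rho>\<^sub>0] by (auto simp: eventually_sequentially)
    \<comment> \<open>Functionals activated in round \<open>k + 1\<close> have norms above
      \<open>A\<close> and at most \<open>A / q\<close> for the \<open>A\<close> below; the factor 2
      makes room for the closed right end.\<close>
    obtain N where N: "\<And>A. A > 0 \<Longrightarrow> card {t \<in> T. A \<le> norm t \<and> norm t < A * (2 / q)} \<le> N"
      using T unfolding lacunary_set_def by meson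
    have card_act: "card (act b (Suc k)) \<le> N" for k
    proof -
      define A where "A = 1 / (4 * snd (b k))"
      have "A > 0" using pos[of k] by (simp add: A_def)
      have "act b (Suc k) \<subseteq> {t \<in> T. A \<le> norm t \<and> norm t < A * (2 / q)}"
      proof
        fix t assume t: "t \<in> act b (Suc k)"
        then have "4 * norm t * (q * snd (b k)) \<le> 1" "1 < 4 * norm t * snd (b k)"
          by (auto simp: act_def Suc_rad)
        then show "t \<in> {t \<in> T. A \<le> norm t \<and> norm t < A * (2 / q)}"
          using t pos[of k] q by (auto simp: act_def A_def field_simps)
      qed
      moreover have "finite {t \<in> T. A \<le> norm t \<and> norm t < A * (2 / q)}"
        using T \<open>A > 0\<close> unfolding lacunary_set_def by meson
      ultimately have "card (act b (Suc k)) \<le> card {t \<in> T. A \<le> norm t \<and> norm t < A * (2 / q)}"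
        by (intro card_mono)
      also have "\<dots> \<le> N" by (rule N) fact
      finally show ?thesis .
    qed
    define W where "W k = sum (wt k) (D b k)" for k
    \<comment> \<open>Bob's next centre lies within \<open>\<alpha> - q\<close> times the old radius
      of Alice's centre. A hyperplane in danger there is thus within relative distance
      \<open>(\<alpha> - q) + 2 * q \<le> 2 * \<alpha>\<close> of Alice's centre, hence in
      \<open>near\<close>. All other elements of the new \<open>D\<close> have just been
      activated.\<close>
    have DSuc: "D b (Suc k) \<subseteq> near b k (a k) \<union> Pair (Suc k) ` act b (Suc k)" for k
    proof
      fix p assume p: "p \<in> D b (Suc k)"
      show "p \<in> near b k (a k) \<union> Pair (Suc k) ` act b (Suc k)"
      proof (cases "fst p = Suc k")
        case True
        then show ?thesis using p by (cases p) (auto simp: D_def)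
      next
        case False
        then have pk: "p \<in> D b k" using p by (auto simp: D_def)
        have "dng b p (Suc k)" using p by (auto simp: D_def)
        then have d: "\<bar>snd p \<bullet> fst (b (Suc k)) - off b p\<bar> \<le> 2 * norm (snd p) * (q * snd (b k))"
          by (simp add: dng_def Suc_rad)
        have "q * snd (b k) + dist (fst (a k)) (fst (b (Suc k))) \<le> \<alpha> * snd (b k)"
          using alice[of k] bob[of k] Suc_rad[of k] by (simp add: alice_legal_def bob_legal_def sle_def)
        then have "\<bar>snd p \<bullet> (fst (a k) - fst (b (Suc k)))\<bar> \<le> norm (snd p) * (\<alpha> * snd (b k) - q * snd (b k))"
          by (intro order_trans[OF Cauchy_Schwarz_ineq2] mult_left_mono) (auto simp: dist_norm)
        with d have "\<bar>snd p \<bullet> fst (a k) - off b p\<bar> \<le> norm (snd p) * (\<alpha> * snd (b k) + q * snd (b k))"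
          by (simp add: inner_diff_right algebra_simps)
        also have "\<dots> \<le> norm (snd p) * (2 * \<alpha> * snd (b k))"
          using \<alpha> \<beta> pos[of k] by (intro mult_left_mono) (auto simp: q_def)
        finally show ?thesis using pk by (auto simp: near_def mult_ac)
      qed
    qed
    \<comment> \<open>Alice quarters the total weight, ageing doubles it, and at most \<open>N\<close> new hyperplanes appear.\<close>
    have "W (Suc k) \<le> W k / 2 + N" if "k \<ge> k0" for k
    proof -
      have fin: "finite (near b k (a k))" "finite (act b (Suc k))" "finite (D b (Suc k))"
        using finD finact pos by (auto simp: near_def)
      have "W (Suc k) \<le> sum (wt (Suc k)) (near b k (a k) \<union> Pair (Suc k) ` act b (Suc k))"
        unfolding W_def using DSuc fin by (intro sum_mono2) (auto simp: wt_def)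
      also have "\<dots> \<le> sum (wt (Suc k)) (near b k (a k)) + sum (wt (Suc k)) (Pair (Suc k) ` act b (Suc k))"
        using fin by (subst sum.union_inter[symmetric]) (auto simp: wt_def sum_nonneg)
      also have "sum (wt (Suc k)) (near b k (a k)) = 2 * sum (wt k) (near b k (a k))"
        unfolding sum_distrib_left
        by (intro sum.cong) (auto simp: wt_def near_def D_def Suc_diff_le)
      also have "sum (wt (Suc k)) (Pair (Suc k) ` act b (Suc k)) = real (card (act b (Suc k)))"
        by (subst sum.reindex) (auto simp: wt_def inj_on_def)
      also have "2 * sum (wt k) (near b k (a k)) + real (card (act b (Suc k))) \<le> 2 * (W k / 4) + N"
        using P[of k] k0[OF that] card_act[of k] by (auto simp: P_def W_def)
      finally show ?thesis by simp
    qed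
    then obtain B where B: "\<And>k. W k \<le> B"
      by (rule halving_sequence_bounded) (auto simp: W_def wt_def sum_nonneg)
    \<comment> \<open>A hyperplane in danger through \<open>r\<close> rounds after its activation
      would weigh \<open>2 ^ r > B\<close>, so danger ends within \<open>r\<close> rounds. In
      \<open>c\<close>, 1/4 handles the integers other than the nearest one, the other term handles
      the nearest one.\<close>
    obtain r where r: "B < 2 ^ r" using real_arch_pow[of 2 B] by auto
    define c where "c = min (1/4) (min (snd (b 0)) (q / 4) * q ^ r)"
    have "c \<le> \<bar>t \<bullet> x - s - of_int m\<bar>" if t: "t \<in> T" for t m
    proof -
      have "\<exists>j. 4 * norm t * snd (b j) \<le> 1"
      proof -
        have "(\<lambda>j. 4 * norm t * snd (b j)) \<longlonglongrightarrow> 0" using tendsto_mult_right_zero[OF tend] .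
        then have "\<forall>\<^sub>F j in sequentially. 4 * norm t * snd (b j) < 1" by (rule order_tendstoD) simp
        then show ?thesis by (auto simp: eventually_sequentially intro: less_imp_le)
      qed
      then obtain j where j: "4 * norm t * snd (b j) \<le> 1" "\<And>i. i < j \<Longrightarrow> 1 < 4 * norm t * snd (b i)"
        using exists_least_iff[of "\<lambda>j. 4 * norm t * snd (b j) \<le> 1"] by (auto simp: not_le)
      then have act: "t \<in> act b j" using t by (auto simp: act_def)
      \<comment> \<open>At activation, norm times radius is bounded below: for \<open>j = 0\<close>
        by \<open>1 \<le> norm t\<close>, later because the activation test still failed one round
        before.\<close>
      have low: "min (snd (b 0)) (q / 4) \<le> norm t * snd (b j)"
      proof (cases j)
        case 0
        have "1 * snd (b 0) \<le> norm t * snd (b 0)" using T1[OF t] b0 by (intro mult_right_mono) auto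
        then show ?thesis unfolding 0 by (intro min.coboundedI1) simp
      next
        case (Suc i)
        then have "q * 1 \<le> q * (4 * norm t * snd (b i))" using j(2)[of i] q by (intro mult_left_mono) auto
        then have "q / 4 \<le> norm t * snd (b (Suc i))" by (simp add: Suc_rad algebra_simps)
        then show ?thesis unfolding Suc by (rule min.coboundedI2)
      qed
      have near: "\<bar>t \<bullet> x - t \<bullet> fst (b i)\<bar> \<le> norm t * snd (b i)" for i
      proof -
        have "\<bar>t \<bullet> (x - fst (b i))\<bar> \<le> norm t * norm (x - fst (b i))" by (rule Cauchy_Schwarz_ineq2)
        also have "\<dots> \<le> norm t * snd (b i)"
          using x[of i] by (intro mult_left_mono) (auto simp: dist_norm norm_minus_commute)
        finally show ?thesis by (simp add: inner_diff_right)
      qed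
      show ?thesis
      proof (cases "m = round (t \<bullet> fst (b j) - s)")
        \<comment> \<open>Such an integer is at least 1/2 away from the value at the centre, and the
          value at \<open>x\<close> differs from that by at most 1/4.\<close>
        case False
        define z where "z = t \<bullet> fst (b j) - s"
        have "1 \<le> \<bar>round z - m\<bar>" using False by (simp add: z_def)
        then have "1 \<le> \<bar>of_int (round z) - of_int m :: real\<bar>"
          by (metis of_int_1_le_iff of_int_abs of_int_diff)
        moreover have "\<bar>of_int (round z) - z\<bar> \<le> 1/2" by (rule of_int_round_abs_le)
        moreover have "\<bar>t \<bullet> x - s - z\<bar> \<le> 1/4" using near[of j] j(1) by (simp add: z_def)
        ultimately have "1/4 \<le> \<bar>t \<bullet> x - s - of_int m\<bar>" by linarith
        then show ?thesis unfolding c_def by (rule min.coboundedI1)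
      next
        case True
        have "\<exists>l\<in>{j..j+r}. \<not> dng b (j, t) l"
        proof (rule ccontr)
          assume "\<not> ?thesis"
          then have "(j, t) \<in> D b (j + r)" using act by (auto simp: D_def)
          then have "wt (j + r) (j, t) \<le> W (j + r)"
            unfolding W_def using finD pos by (intro member_le_sum) (auto simp: wt_def)
          then show False using r B[of "j + r"] by (simp add: wt_def)
        qed
        then obtain l where l: "j \<le> l" "l \<le> j + r" "\<not> dng b (j, t) l" by auto
        have "min (snd (b 0)) (q / 4) * q ^ r \<le> norm t * snd (b j) * q ^ (l - j)"
          using low q pos[of 0] pos[of j] l by (intro mult_mono power_decreasing) auto
        also have "\<dots> = norm t * snd (b l)" using rad[of "l - j" j] l by simp
        \<comment> \<open>Out of danger, the value at the centre is more than
          \<open>2 * norm t * snd (b l)\<close> away; passing to \<open>x\<close> costs at most half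
          of this.\<close>
        also have "\<dots> \<le> \<bar>t \<bullet> x - s - of_int m\<bar>"
          using l(3) near[of l] True by (simp add: dng_def off_def)
        finally show ?thesis unfolding c_def by (rule min.coboundedI2)
      qed
    qed
    moreover have "c > 0" using q b0 by (simp add: c_def)
    ultimately show "x \<in> {x. \<exists>c>0. \<forall>t\<in>T. \<forall>m::int. c \<le> \<bar>t \<bullet> x - s - m\<bar>}" by blast
  qed
qed

section \<open>Growth of orbits of integer matrices\<close>

text \<open>This is p(A) v, written in orbit points, so that annihilating polynomials are linear
  relations along the orbit.\<close>

definition poly_act :: "'a::field^'n::finite^'n \<Rightarrow> 'a poly \<Rightarrow> 'a^'n \<Rightarrow> 'a^'n" where
  "poly_act A p v = (\<Sum>i\<le>degree p. poly.coeff p i *s ((\<lambda>v. A *v v) ^^ i) v)"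

lemma poly_act_eq_sum:
  assumes "degree p \<le> n"
  shows "poly_act A p v = (\<Sum>i\<le>n. poly.coeff p i *s ((\<lambda>v. A *v v) ^^ i) v)"
  unfolding poly_act_def using assms
  by (intro sum.mono_neutral_left) (auto simp: coeff_eq_0)

lemma poly_act_0 [simp]: "poly_act A 0 v = 0"
  by (simp add: poly_act_def)

lemma poly_act_1 [simp]: "poly_act A 1 v = v"
  by (simp add: poly_act_def)

lemma poly_act_add: "poly_act A (p + q) v = poly_act A p v + poly_act A q v"
  by (subst (1 2 3) poly_act_eq_sum[of _ "max (degree p) (degree q)"])
    (auto simp: degree_add_le_max sum.distrib vec.scale_left_distrib)

lemma poly_act_smult: "poly_act A (smult c p) v = c *s poly_act A p v"
  by (subst (1 2) poly_act_eq_sum[of _ "degree p"])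
    (auto simp: degree_smult_le vec.scale_sum_right)

lemma poly_act_sum: "poly_act A (\<Sum>i\<in>I. p i) v = (\<Sum>i\<in>I. poly_act A (p i) v)"
  by (induction I rule: infinite_finite_induct) (auto simp: poly_act_add)

lemma poly_act_pCons: "poly_act A (pCons a p) v = a *s v + A *v poly_act A p v"
proof -
  have "poly_act A (pCons a p) v =
      (\<Sum>i\<le>Suc (degree p). poly.coeff (pCons a p) i *s ((\<lambda>v. A *v v) ^^ i) v)"
    by (rule poly_act_eq_sum) (rule degree_pCons_le)
  also have "\<dots> = a *s v + (\<Sum>i\<le>degree p. poly.coeff p i *s (A *v ((\<lambda>v. A *v v) ^^ i) v))"
    by (subst sum.atMost_Suc_shift) simp
  also have "\<dots> = a *s v + A *v poly_act A p v"
    by (simp add: poly_act_def vec.linear_sum[OF matrix_vector_mul_linear_gen] vector_scalar_commute)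
  finally show ?thesis .
qed

lemma poly_act_mult: "poly_act A (p * q) v = poly_act A p (poly_act A q v)"
  by (induction p) (simp_all add: poly_act_add poly_act_smult poly_act_pCons)

lemma poly_act_add_right: "poly_act A p (v + w) = poly_act A p v + poly_act A p w"
  by (induction p) (simp_all add: poly_act_pCons matrix_vector_right_distrib vec.scale_right_distrib)

lemma poly_act_scale_right: "poly_act A p (c *s v) = c *s poly_act A p v"
  by (induction p) (simp_all add: poly_act_pCons vector_scalar_commute vec.scale_right_distrib mult.commute)

lemma poly_act_commute: "poly_act A p (((\<lambda>v. A *v v) ^^ k) v) = ((\<lambda>v. A *v v) ^^ k) (poly_act A p v)"
proof (induction k)
  case (Suc k)
  have "poly_act A p (A *v w) = A *v poly_act A p w" for w
    using poly_act_mult[of A p "[:0, 1:]" w] poly_act_mult[of A "[:0, 1:]" p w]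
    by (simp add: poly_act_pCons mult.commute)
  then show ?case using Suc by simp
qed simp

text \<open>The first \<open>n + 1\<close> orbit points are dependent in dimension \<open>n\<close>.
  A repetition among them is treated apart, since the set of these points may then be too small for
  the dimension count; it yields a difference of two monomials.\<close>

lemma poly_act_annihilator_exists:
  fixes A :: "'a::field^'n::finite^'n"
  obtains p where "p \<noteq> 0" "poly_act A p v = 0"
proof -
  define t where "t i = ((\<lambda>v. A *v v) ^^ i) v" for i
  define n where "n = CARD('n)"
  show thesis
  proof (cases "inj_on t {..n}")
    case False
    then obtain i j where ij: "i \<noteq> j" "t i = t j" by (auto simp: inj_on_def)
    have tm: "poly_act A (monom 1 k) v = t k" for k
      by (simp add: poly_act_def degree_monom_eq t_def if_distrib[of "\<lambda>c. c *s _"] sum.delta cong: if_cong)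
    define p :: "'a poly" where "p = monom 1 i + smult (- 1) (monom 1 j)"
    have "poly_act A p v = 0"
      using ij by (simp add: p_def poly_act_add poly_act_smult tm del: smult_minus_left)
    moreover have "poly.coeff p i = 1" using ij by (simp add: p_def)
    then have "p \<noteq> 0" by auto
    ultimately show thesis by (intro that)
  next
    case True
    have "vec.dependent (t ` {..n})"
    proof (rule vec.dependent_biggerset_general)
      have "vec.dim (t ` {..n}) \<le> n"
        unfolding n_def by (rule dim_subset_UNIV_cart_gen)
      also have "\<dots> < card (t ` {..n})" using True by (simp add: card_image)
      finally show "vec.dim (t ` {..n}) < card (t ` {..n})" .
    qed
    then obtain u w where u: "(\<Sum>x\<in>t ` {..n}. u x *s x) = 0" "w \<in> t ` {..n}" "u w \<noteq> 0"
      by (auto simp: vec.dependent_finite)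
    then obtain i where i: "i \<le> n" "u (t i) \<noteq> 0" by auto
    define p where "p = (\<Sum>i\<le>n. monom (u (t i)) i)"
    have cf: "poly.coeff p k = (if k \<le> n then u (t k) else 0)" for k
      by (simp add: p_def coeff_sum if_distrib sum.delta cong: if_cong)
    then have "degree p \<le> n" by (intro degree_le) auto
    then have "poly_act A p v = (\<Sum>i\<le>n. u (t i) *s t i)"
      by (subst poly_act_eq_sum[of _ n]) (auto simp: cf t_def)
    also have "\<dots> = 0" using u(1) True by (simp add: sum.reindex)
    finally have "poly_act A p v = 0" .
    moreover have "p \<noteq> 0" using cf[of i] i by auto
    ultimately show thesis by (intro that)
  qed
qed

section \<open>Squarefree annihilators over the rationals\<close>

lemma map_poly_of_rat_simps:
  "map_poly of_rat (p + q) = (map_poly of_rat p + map_poly of_rat q :: 'a::field_char_0 poly)"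
  "map_poly of_rat (smult c p) = (smult (of_rat c) (map_poly of_rat p) :: 'a poly)"
  "map_poly of_rat (p * q) = (map_poly of_rat p * map_poly of_rat q :: 'a poly)"
  "map_poly of_rat (pderiv p) = (pderiv (map_poly of_rat p) :: 'a poly)"
proof -
  show add: "map_poly of_rat (p + q) = (map_poly of_rat p + map_poly of_rat q :: 'a poly)" for p q
    by (intro poly_eqI) (simp add: coeff_map_poly of_rat_add)
  show smult: "map_poly of_rat (smult c p) = (smult (of_rat c) (map_poly of_rat p) :: 'a poly)" for c p
    by (intro poly_eqI) (simp add: coeff_map_poly of_rat_mult)
  show "map_poly of_rat (p * q) = (map_poly of_rat p * map_poly of_rat q :: 'a poly)"
    by (induction p) (simp_all add: add smult map_poly_pCons)
  show "map_poly of_rat (pderiv p) = (pderiv (map_poly of_rat p) :: 'a poly)"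
    by (intro poly_eqI) (simp add: coeff_map_poly coeff_pderiv of_rat_mult del: of_nat_Suc)
qed

lemma squarefree_annihilator_exists:
  fixes A :: "rat^'n::finite^'n"
  obtains v f where "v \<noteq> 0" "poly_act A f v = 0" "rsquarefree (map_poly of_rat f :: complex poly)"
proof -
  \<comment> \<open>Minimality of \<open>degree f\<close> over all nonzero \<open>v\<close> makes \<open>f\<close> squarefree: a factor \<open>h\<close> shared with the
    derivative would annihilate \<open>(f / h)(A) v \<noteq> 0\<close>.\<close>
  define Q where "Q = (\<lambda>(v, f). v \<noteq> 0 \<and> f \<noteq> 0 \<and> poly_act A f v = 0)"
  have "axis undefined 1 \<noteq> (0 :: rat^'n)" by (simp add: axis_eq_0_iff)
  moreover obtain f\<^sub>0 where "f\<^sub>0 \<noteq> 0" "poly_act A f\<^sub>0 (axis undefined 1) = 0"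
    by (rule poly_act_annihilator_exists)
  ultimately have "Q (axis undefined 1, f\<^sub>0)" by (simp add: Q_def)
  then obtain vf where Qvf: "Q vf" and "\<And>wg. Q wg \<Longrightarrow> degree (snd vf) \<le> degree (snd wg)"
    using ex_has_least_nat[of Q _ "\<lambda>wg. degree (snd wg)"] by blast
  then obtain v f where vf: "v \<noteq> 0" "f \<noteq> 0" "poly_act A f v = 0"
    and min: "\<And>w g. w \<noteq> 0 \<Longrightarrow> g \<noteq> 0 \<Longrightarrow> poly_act A g w = 0 \<Longrightarrow> degree f \<le> degree g"
    by (cases vf) (force simp: Q_def)
  let ?ev = "\<lambda>p z. poly (map_poly of_rat p :: complex poly) z"
  have "\<not> (?ev f z = 0 \<and> ?ev (pderiv f) z = 0)" for z
  proof
    assume z: "?ev f z = 0 \<and> ?ev (pderiv f) z = 0"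
    \<comment> \<open>Up to a scalar, \<open>h\<close> is the minimal polynomial of the common root
      \<open>z\<close> over the rationals; division with remainder shows that it divides every
      rational polynomial vanishing at \<open>z\<close>.\<close>
    obtain h where h: "h \<noteq> 0" "?ev h z = 0"
      and hmin: "\<And>p. p \<noteq> 0 \<Longrightarrow> ?ev p z = 0 \<Longrightarrow> degree h \<le> degree p"
      using ex_has_least_nat[of "\<lambda>p. p \<noteq> 0 \<and> ?ev p z = 0" f degree] vf z by blast
    have dvd: "h dvd p" if "?ev p z = 0" for p
    proof (rule ccontr)
      assume "\<not> h dvd p"
      moreover have "?ev (h * (p div h) + p mod h) z = 0" using that by simp
      then have "?ev (p mod h) z = 0" using h by (simp only: map_poly_of_rat_simps poly_add poly_mult) simp
      ultimately show False using hmin[of "p mod h"] degree_mod_less'[of h p] h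
        by (auto simp: mod_eq_0_iff_dvd)
    qed
    have const: "degree p > 0" if "p \<noteq> 0" "?ev p z = 0" for p
      using that by (cases p) (auto simp: map_poly_pCons split: if_splits)
    obtain g where g: "f = h * g" using dvd z by blast
    have "degree f > 0" using const vf z by blast
    \<comment> \<open>In characteristic 0 the derivative is nonzero of smaller degree and vanishes
      at \<open>z\<close>, which bounds the degree of \<open>h\<close>.\<close>
    then have "pderiv f \<noteq> 0" "degree (pderiv f) < degree f" by (auto simp: pderiv_eq_0_iff degree_pderiv)
    then have hf: "degree h < degree f" using hmin[of "pderiv f"] z by simp
    have "g \<noteq> 0" using g vf by auto
    moreover have "degree g < degree f" using g vf const[OF h] by (simp add: degree_mult_eq)
    ultimately have "poly_act A g v \<noteq> 0" using min[of v g] vf by auto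
    moreover have "poly_act A h (poly_act A g v) = 0" using vf g by (simp add: poly_act_mult)
    ultimately show False using min[of "poly_act A g v" h] h hf by simp
  qed
  then have "rsquarefree (map_poly of_rat f :: complex poly)"
    by (simp add: rsquarefree_roots map_poly_of_rat_simps)
  then show thesis using vf by (intro that)
qed

section \<open>Two-sided exponential growth over the complex numbers\<close>

lemma norm_vector_scalar_mult:
  fixes v :: "'a::real_normed_field^'n::finite"
  shows "norm (c *s v) = norm c * norm v"
  by (simp add: norm_vec_def norm_mult L2_set_right_distrib)

lemma poly_act_bounded:
  fixes A :: "complex^'n::finite^'n"
  obtains C where "0 < C" "\<And>v. norm (poly_act A p v) \<le> C * norm v"
proof -
  have scaleR: "r *\<^sub>R v = of_real r *s v" for r and v :: "complex^'n"
    by (simp add: vec_eq_iff) (simp add: scaleR_conv_of_real)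
  have "linear (poly_act A p)"
    by (rule linearI) (simp_all add: poly_act_add_right poly_act_scale_right scaleR)
  then show thesis using linear_bounded_pos that by blast
qed

text \<open>Distinct roots make \<open>v\<close> a sum of eigenvectors \<open>w z\<close>, so the
  orbit is the sum of the \<open>z ^ k *s w z\<close>, without polynomial factors in
  \<open>k\<close>. \<open>R\<close> is the largest modulus of a root with
  \<open>w z \<noteq> 0\<close>. The triangle inequality gives the upper bound. For the lower one, a
  fixed bounded map isolates the term of one dominant root, so cancellation between roots of equal
  modulus does no harm.\<close>

lemma squarefree_annihilator_growth:
  fixes A :: "complex^'n::finite^'n"
  assumes f: "rsquarefree f" "poly_act A f v = 0" and v: "v \<noteq> 0"
  obtains R c C where "0 \<le> R" "0 < c" "0 < C"
    "\<And>k. c * R ^ k \<le> norm (((\<lambda>v. A *v v) ^^ k) v)" "\<And>k. norm (((\<lambda>v. A *v v) ^^ k) v) \<le> C * R ^ k"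
proof -
  have f0: "f \<noteq> 0" using f(1) by (auto simp: rsquarefree_def)
  define Z where "Z = {z. poly f z = 0}"
  have finZ: "finite Z" using f0 by (simp add: Z_def poly_roots_finite)
  have fZ: "f = smult (lead_coeff f) (\<Prod>z\<in>Z. [:-z, 1:])"
    using complex_poly_decompose_rsquarefree[OF f(1)] by (simp add: Z_def)
  have Zne: "Z \<noteq> {}"
  proof
    assume "Z = {}"
    then have "poly_act A f v = lead_coeff f *s v" by (subst fZ) (simp add: poly_act_pCons)
    then show False using f f0 v by simp
  qed
  define g where "g z = (\<Prod>x\<in>Z - {z}. [:-x, 1:])" for z
  \<comment> \<open>The Lagrange polynomials for the nodes \<open>Z\<close> act on \<open>v\<close>.
    They sum to 1, as their sum has degree below \<open>card Z\<close> and equals 1 on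
    \<open>Z\<close>.\<close>
  define w where "w z = poly_act A (smult (inverse (poly (g z) z)) (g z)) v" for z
  have gz: "poly (g z) z \<noteq> 0" for z using finZ by (auto simp: g_def poly_prod)
  have gx: "poly (g z) x = 0" if "x \<in> Z" "x \<noteq> z" for x z
    using that finZ by (auto simp: g_def poly_prod intro!: prod_zero bexI[of _ x])
  have lagrange: "(\<Sum>z\<in>Z. smult (inverse (poly (g z) z)) (g z)) = 1"
  proof (rule poly_eqI_degree)
    fix x assume x: "x \<in> Z"
    have "poly (\<Sum>z\<in>Z. smult (inverse (poly (g z) z)) (g z)) x = (\<Sum>z\<in>Z. if z = x then 1 else 0)"
      unfolding poly_sum using gx x gz by (intro sum.cong) auto
    then show "poly (\<Sum>z\<in>Z. smult (inverse (poly (g z) z)) (g z)) x = poly 1 x"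
      using x finZ by simp
  next
    have "degree (g z) < card Z" if "z \<in> Z" for z
    proof -
      have "degree (g z) = card (Z - {z})" unfolding g_def
        by (subst degree_prod_eq_sum_degree) auto
      then show ?thesis using that finZ by (metis card_Diff1_less)
    qed
    then show "degree (\<Sum>z\<in>Z. smult (inverse (poly (g z) z)) (g z)) < card Z"
      using Zne finZ by (intro degree_sum_less) (auto simp: card_gt_0_iff)
    show "degree 1 < card Z" using Zne finZ by (simp add: card_gt_0_iff)
  qed
  \<comment> \<open>Applying \<open>[:-z, 1:]\<close> to \<open>w z\<close> gives a scalar multiple
    of \<open>poly_act A f v\<close>, hence 0.\<close>
  have eig: "A *v w z = z *s w z" if z: "z \<in> Z" for z
  proof -
    have "f = smult (lead_coeff f) ([:-z, 1:] * g z)"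
      by (subst fZ) (simp add: g_def prod.remove[OF finZ z])
    then have "0 = lead_coeff f *s poly_act A ([:-z, 1:] * g z) v"
      using f(2) by (metis poly_act_smult)
    then have "poly_act A ([:-z, 1:] * g z) v = 0" using f0 by simp
    then have "poly_act A [:-z, 1:] (w z) = 0"
      by (simp only: w_def poly_act_mult poly_act_smult poly_act_scale_right vec.scale_zero_right)
    then show ?thesis by (simp add: poly_act_pCons)
  qed
  have eigk: "((\<lambda>v. A *v v) ^^ k) (w z) = z ^ k *s w z" if "z \<in> Z" for z k
    by (induction k) (simp_all add: vector_scalar_commute eig[OF that])
  have wk: "poly_act A (smult (inverse (poly (g z) z)) (g z)) (((\<lambda>v. A *v v) ^^ k) v) = z ^ k *s w z"
    if "z \<in> Z" for z k
    using eigk[OF that] by (simp add: poly_act_commute w_def)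
  have sum: "((\<lambda>v. A *v v) ^^ k) v = (\<Sum>z\<in>Z. z ^ k *s w z)" for k
    using arg_cong[OF lagrange, of "\<lambda>p. poly_act A p (((\<lambda>v. A *v v) ^^ k) v)"] wk
    by (simp add: poly_act_sum)
  define Z' where "Z' = {z \<in> Z. w z \<noteq> 0}"
  have finZ': "finite Z'" using finZ by (simp add: Z'_def)
  have "Z' \<noteq> {}"
  proof
    assume "Z' = {}"
    then have "v = 0" using sum[of 0] by (simp add: Z'_def)
    then show False using v by simp
  qed
  then have "Max (norm ` Z') \<in> norm ` Z'" using finZ' by (intro Max_in) auto
  then obtain z0 where z0: "z0 \<in> Z'" "norm z0 = Max (norm ` Z')" by force
  have z0_max: "norm z \<le> norm z0" if "z \<in> Z'" for z
    unfolding z0(2) using that finZ' by (intro Max_ge) auto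
  obtain B where B: "0 < B"
    "\<And>u. norm (poly_act A (smult (inverse (poly (g z0) z0)) (g z0)) u) \<le> B * norm u"
    using poly_act_bounded[of A "smult (inverse (poly (g z0) z0)) (g z0)"] by blast
  show thesis
  proof (rule that)
    show "0 \<le> norm z0" by simp
    show "0 < norm (w z0) / B" using z0 B by (simp add: Z'_def)
    have "0 < norm (w z0)" using z0 by (simp add: Z'_def)
    also have "\<dots> \<le> (\<Sum>z\<in>Z'. norm (w z))" using z0 finZ' by (intro member_le_sum) auto
    finally show "0 < (\<Sum>z\<in>Z'. norm (w z))" .
    fix k
    have "norm (z0 ^ k *s w z0) \<le> B * norm (((\<lambda>v. A *v v) ^^ k) v)"
      using B(2)[of "((\<lambda>v. A *v v) ^^ k) v"] wk[of z0 k] z0 by (simp add: Z'_def)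
    then show "norm (w z0) / B * norm z0 ^ k \<le> norm (((\<lambda>v. A *v v) ^^ k) v)"
      using B(1) by (simp add: norm_vector_scalar_mult norm_power field_simps)
    have "((\<lambda>v. A *v v) ^^ k) v = (\<Sum>z\<in>Z'. z ^ k *s w z)"
      unfolding sum using finZ by (intro sum.mono_neutral_right) (auto simp: Z'_def)
    also have "norm \<dots> \<le> (\<Sum>z\<in>Z'. norm z0 ^ k * norm (w z))"
      by (intro order_trans[OF norm_sum] sum_mono)
        (auto simp: norm_vector_scalar_mult norm_power intro!: mult_right_mono power_mono z0_max)
    finally show "norm (((\<lambda>v. A *v v) ^^ k) v) \<le> (\<Sum>z\<in>Z'. norm (w z)) * norm z0 ^ k"
      by (simp add: sum_distrib_left mult.commute)
  qed
qed

section \<open>Transfer between rational, real and complex vectors\<close>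

lemma poly_act_of_rat:
  fixes A :: "rat^'n::finite^'n"
  shows "poly_act (\<chi> i j. of_rat (A $ i $ j)) (map_poly of_rat p) (\<chi> i. of_rat (v $ i)) =
    ((\<chi> i. of_rat (poly_act A p v $ i)) :: 'a::field_char_0^'n)"
  by (induction p)
    (simp_all add: poly_act_pCons map_poly_pCons vec_eq_iff matrix_vector_mult_def of_rat_add of_rat_mult of_rat_sum)

lemma funpow_matrix_of_rat:
  fixes A :: "rat^'n::finite^'n"
  shows "((\<lambda>v. (\<chi> i j. of_rat (A $ i $ j)) *v v) ^^ k) (\<chi> i. of_rat (v $ i)) =
    ((\<chi> i. of_rat ((((\<lambda>v. A *v v) ^^ k) v) $ i)) :: 'a::field_char_0^'n)"
  by (induction k) (simp_all add: vec_eq_iff matrix_vector_mult_def of_rat_mult of_rat_sum)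

text \<open>Growth is proved over the complex numbers but needed for real vectors.\<close>

lemma norm_vec_of_rat:
  "norm ((\<chi> i. of_rat (v $ i)) :: complex^'n::finite) = norm ((\<chi> i. of_rat (v $ i)) :: real^'n)"
proof -
  have "of_rat q = complex_of_real (of_rat q)" for q
    by (cases q) (simp add: of_rat_rat)
  then have "norm (of_rat q :: complex) = norm (of_rat q :: real)" for q
    by (metis norm_of_real real_norm_def)
  then show ?thesis by (simp add: norm_vec_def)
qed

lemma rat_vec_clear_denominators:
  fixes v :: "rat^'n::finite"
  obtains d :: int where "d > 0" "\<And>i. \<exists>m::int. of_int d * v $ i = of_int m"
proof (rule that)
  let ?d = "\<lambda>i. snd (quotient_of (v $ i))"
  show "(\<Prod>i\<in>UNIV. ?d i) > 0" by (intro prod_pos) (simp add: quotient_of_denom_pos')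
  fix i
  have "v $ i = of_int (fst (quotient_of (v $ i))) / of_int (?d i)"
    by (simp add: quotient_of_div)
  moreover have "?d i \<noteq> 0" using quotient_of_denom_pos'[of "v $ i"] by simp
  ultimately have "of_int (?d i) * v $ i = of_int (fst (quotient_of (v $ i)))"
    by (metis nonzero_mult_div_cancel_left of_int_eq_0_iff times_divide_eq_right)
  then have "of_int (\<Prod>i\<in>UNIV. ?d i) * v $ i = of_int ((\<Prod>j\<in>UNIV-{i}. ?d j) * fst (quotient_of (v $ i)))"
    by (subst prod.remove[of UNIV i]) (simp_all add: mult_ac)
  then show "\<exists>m::int. of_int (\<Prod>i\<in>UNIV. ?d i) * v $ i = of_int m" by blast
qed

section \<open>Integer vectors and lacunary orbits\<close>

lemma finite_int_vectors_bounded: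
  "finite {t \<in> int_vectors. norm (t :: real^'n::finite) \<le> B}"
proof (rule finite_subset)
  let ?X = "of_int ` {-\<lceil>B\<rceil>..\<lceil>B\<rceil>} :: real set"
  show "{t \<in> int_vectors. norm (t :: real^'n) \<le> B} \<subseteq> vec_lambda ` (UNIV \<rightarrow>\<^sub>E ?X)"
  proof
    fix t :: "real^'n" assume t: "t \<in> {t \<in> int_vectors. norm t \<le> B}"
    have "t $ i \<in> ?X" for i
    proof -
      have "t $ i \<in> \<int>" using t by (simp add: int_vectors_def)
      then obtain m where m: "t $ i = of_int m" by (rule Ints_cases)
      have "\<bar>t $ i\<bar> \<le> B" using t component_le_norm_cart[of t i] by simp
      then have "\<bar>m\<bar> \<le> \<lceil>B\<rceil>" unfolding m by linarith
      then have "m \<in> {-\<lceil>B\<rceil>..\<lceil>B\<rceil>}" by auto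
      then show ?thesis unfolding m by (rule imageI)
    qed
    then have "t = vec_lambda (vec_nth t)" "vec_nth t \<in> UNIV \<rightarrow>\<^sub>E ?X" by auto
    then show "t \<in> vec_lambda ` (UNIV \<rightarrow>\<^sub>E ?X)" by blast
  qed
  show "finite (vec_lambda ` ((UNIV :: 'n set) \<rightarrow>\<^sub>E ?X))"
    by (intro finite_imageI finite_PiE) auto
qed

lemma int_vectors_norm_ge_1:
  assumes "t \<in> int_vectors" "t \<noteq> 0"
  shows "1 \<le> norm t"
proof -
  obtain i where i: "t $ i \<noteq> 0" using assms(2) by (auto simp: vec_eq_iff)
  have "t $ i \<in> \<int>" using assms(1) by (simp add: int_vectors_def)
  then have "1 \<le> \<bar>t $ i\<bar>" using i by (rule Ints_nonzero_abs_ge1)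
  also have "\<dots> \<le> norm t" by (rule component_le_norm_cart)
  finally show ?thesis .
qed

text \<open>For \<open>R \<le> 1\<close> the sequence is bounded, so integrality makes its range
  finite. Otherwise the two-sided bound replaces monotonicity of the norms: a window starting at
  \<open>A\<close> only meets the \<open>m\<close> indices that begin with the first one whose norm
  reaches \<open>A\<close>.\<close>

lemma geometric_growth_lacunary_set:
  fixes t :: "nat \<Rightarrow> real^'n::finite"
  assumes int: "\<And>k. t k \<in> int_vectors" and nz: "\<And>k. t k \<noteq> 0"
    and pos: "0 \<le> R" "0 < c" "0 < C"
    and lower: "\<And>k. c * R ^ k \<le> norm (t k)" and upper: "\<And>k. norm (t k) \<le> C * R ^ k"
  shows "lacunary_set (range t)"
  unfolding lacunary_set_def
proof (intro conjI ballI allI)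
  show "1 \<le> norm u" if "u \<in> range t" for u
    using that int nz int_vectors_norm_ge_1 by blast
  fix H :: real
  let ?S = "\<lambda>A. {u \<in> range t. A \<le> norm u \<and> norm u < A * H}"
  show "\<exists>N. \<forall>A>0. finite (?S A) \<and> card (?S A) \<le> N"
  proof (cases "R \<le> 1")
    case True
    have "norm (t k) \<le> C" for k
      using order_trans[OF upper mult_left_mono[OF power_le_one[OF pos(1) True]]] pos by simp
    then have "range t \<subseteq> {t \<in> int_vectors. norm t \<le> C}" using int by auto
    then have fin: "finite (range t)" using finite_int_vectors_bounded finite_subset by blast
    have "finite (?S A) \<and> card (?S A) \<le> card (range t)" for A
      using fin by (auto intro!: card_mono)
    then show ?thesis by blast
  next
    case False
    \<comment> \<open>\<open>m\<close> depends on \<open>H\<close>, \<open>c\<close>,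
      \<open>C\<close> and \<open>R\<close> but not on \<open>A\<close>, which makes the count
      uniform.\<close>
    then obtain m where m: "H * C / c < R ^ m" using real_arch_pow[of R] by auto
    have "finite (?S A) \<and> card (?S A) \<le> m" if A: "A > 0" for A
    proof (cases "?S A = {}")
      case False
      then have "\<exists>k. A \<le> norm (t k)" by auto
      then obtain k0 where k0: "A \<le> norm (t k0)" "\<And>k. k < k0 \<Longrightarrow> \<not> A \<le> norm (t k)"
        using exists_least_iff[of "\<lambda>k. A \<le> norm (t k)"] by auto
      have "?S A \<subseteq> t ` {k0..<k0 + m}"
      proof
        fix u assume "u \<in> ?S A"
        then obtain k where k: "u = t k" "A \<le> norm (t k)" "norm (t k) < A * H" by auto
        have "k0 \<le> k" using k0(2) k(2) not_le by blast
        moreover have "k < k0 + m"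
        proof (rule ccontr)
          assume "\<not> k < k0 + m"
          have H: "0 < H" using k A by (smt (verit) mult_nonneg_nonpos norm_ge_zero)
          have "A * H \<le> C * R ^ k0 * H"
            using k0(1) upper[of k0] H by (intro mult_right_mono) auto
          also have "\<dots> = c * R ^ k0 * (H * C / c)" using pos by simp
          also have "\<dots> \<le> c * R ^ k0 * R ^ m" using m pos by (intro mult_left_mono) auto
          also have "\<dots> = c * R ^ (k0 + m)" by (simp add: power_add)
          also have "\<dots> \<le> c * R ^ k"
            using \<open>\<not> k < k0 + m\<close> \<open>\<not> R \<le> 1\<close> pos by (intro mult_left_mono power_increasing) auto
          also have "\<dots> \<le> norm (t k)" by (rule lower)
          finally show False using k(3) by simp
        qed
        ultimately show "u \<in> t ` {k0..<k0 + m}" using k(1) by auto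
      qed
      then have "card (?S A) \<le> card (t ` {k0..<k0 + m})" "finite (?S A)"
        by (auto intro: card_mono finite_subset)
      then show ?thesis using card_image_le[of "{k0..<k0 + m}" t] by simp
    qed (simp only: finite.emptyI card.empty, simp)
    then show ?thesis by blast
  qed
qed

text \<open>The annihilator lives over the rationals, the eigenvectors over the complex numbers and
  the functionals over the reals, so one vector with integer coordinates is read in all three fields
  as \<open>v\<close>, \<open>vC\<close> and \<open>vR\<close>.\<close>

lemma integer_matrix_lacunary_orbit:
  fixes M :: "real^'n::finite^'n"
  assumes M: "integer_matrix M" "det M \<noteq> 0"
  obtains v where "v \<in> int_vectors" "lacunary_set (range (\<lambda>k. ((\<lambda>v. transpose M *v v) ^^ k) v))"
proof -
  \<comment> \<open>The entries of \<open>M\<close> are integers, so the floor is exact; the swapped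
    indices give the transpose.\<close>
  define A :: "rat^'n^'n" where "A = (\<chi> i j. of_int \<lfloor>M $ j $ i\<rfloor>)"
  have A: "transpose M = (\<chi> i j. of_rat (A $ i $ j))"
    using M(1) by (simp add: A_def vec_eq_iff transpose_def integer_matrix_def)
  obtain v0 f where v0: "v0 \<noteq> 0" "poly_act A f v0 = 0"
    and f: "rsquarefree (map_poly of_rat f :: complex poly)"
    by (rule squarefree_annihilator_exists)
  obtain d :: int where d: "d > 0" "\<And>i. \<exists>m::int. of_int d * v0 $ i = of_int m"
    using rat_vec_clear_denominators[of v0] by metis
  define v where "v = of_int d *s v0"
  have v: "v \<noteq> 0" "poly_act A f v = 0" using v0 d(1) by (auto simp: v_def poly_act_scale_right)
  define AC :: "complex^'n^'n" where "AC = (\<chi> i j. of_rat (A $ i $ j))"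
  define vC :: "complex^'n" where "vC = (\<chi> i. of_rat (v $ i))"
  define vR :: "real^'n" where "vR = (\<chi> i. of_rat (v $ i))"
  define t where "t k = ((\<lambda>v. transpose M *v v) ^^ k) vR" for k
  have "poly_act AC (map_poly of_rat f) vC = 0"
    unfolding AC_def vC_def poly_act_of_rat using v by (simp add: vec_eq_iff)
  moreover have "vC \<noteq> 0" using v(1) by (auto simp: vC_def vec_eq_iff)
  ultimately obtain R c C where growth: "0 \<le> R" "0 < c" "0 < C"
    "\<And>k. c * R ^ k \<le> norm (((\<lambda>v. AC *v v) ^^ k) vC)" "\<And>k. norm (((\<lambda>v. AC *v v) ^^ k) vC) \<le> C * R ^ k"
    using squarefree_annihilator_growth[OF f] by metis
  have norm: "norm (((\<lambda>v. AC *v v) ^^ k) vC) = norm (t k)" for k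
    unfolding t_def AC_def vC_def vR_def A funpow_matrix_of_rat by (rule norm_vec_of_rat)
  have vR: "vR \<in> int_vectors"
    unfolding int_vectors_def
  proof safe
    fix i
    obtain m :: int where "of_int d * v0 $ i = of_int m" using d(2) by blast
    then show "vR $ i \<in> \<int>" by (simp add: vR_def v_def)
  qed
  have int: "t k \<in> int_vectors" for k
  proof (induction k)
    case (Suc k)
    then show ?case
      using M(1) by (auto simp: t_def int_vectors_def integer_matrix_def matrix_vector_mult_def transpose_def
          intro!: Ints_sum Ints_mult)
  qed (use vR in \<open>simp add: t_def\<close>)
  have nz: "t k \<noteq> 0" for k
  proof (induction k)
    case 0
    then show ?case using v(1) by (auto simp: t_def vR_def vec_eq_iff)
  next
    case (Suc k)
    \<comment> \<open>The nonzero determinant keeps the orbit off 0, so its integral vectors have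
      norm at least 1.\<close>
    have "invertible (transpose M)" using M(2) by (simp add: invertible_det_nz det_transpose)
    then have "inj (\<lambda>v. transpose M *v v)" by (rule inj_matrix_vector_mult)
    then show ?case using Suc by (auto simp: t_def dest: injD[of _ _ 0])
  qed
  have "lacunary_set (range t)"
    using growth unfolding norm by (intro geometric_growth_lacunary_set[OF int nz, of R c C])
  then show thesis using that[OF vR] by (simp add: t_def)
qed

section \<open>Orbits avoiding a point of the torus\<close>

text \<open>Moves the dynamics from the point to the functional: orbit conditions on
  \<open>x\<close> become conditions relative to a fixed family of hyperplanes.\<close>

lemma inner_funpow_transpose:
  fixes M :: "real^'n::finite^'n"
  shows "((\<lambda>v. transpose M *v v) ^^ k) v \<bullet> x = v \<bullet> ((\<lambda>v. M *v v) ^^ k) x"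
proof (induction k arbitrary: x)
  case (Suc k)
  have "((\<lambda>v. transpose M *v v) ^^ Suc k) v \<bullet> x = ((\<lambda>v. transpose M *v v) ^^ k) v \<bullet> (M *v x)"
    by (simp add: dot_lmul_matrix flip: vector_transpose_matrix)
  also have "\<dots> = v \<bullet> ((\<lambda>v. M *v v) ^^ k) (M *v x)" by (rule Suc)
  finally show ?case by (simp add: funpow_swap1)
qed simp

text \<open>As \<open>v\<close> is integral, the inner product with \<open>v\<close> descends to a
  Lipschitz map from the torus to the circle. If the orbit approached the point, its image would
  approach the image of the point.\<close>

lemma Etilde_if_functional_bounded_away:
  fixes M :: "real^'n::finite^'n"
  assumes v: "v \<in> int_vectors" and c: "c > 0"
    and away: "\<And>k (m::int). c \<le> \<bar>v \<bullet> ((\<lambda>v. M *v v) ^^ k) x - v \<bullet> yl - m\<bar>"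
  shows "x \<in> Etilde M yl"
proof -
  have "yl \<notin> closure {s + m | s m. s \<in> {((\<lambda>v. M *v v) ^^ k) x | k. True} \<and> m \<in> int_vectors}"
  proof
    assume cl: "yl \<in> closure {s + m | s m. s \<in> {((\<lambda>v. M *v v) ^^ k) x | k. True} \<and> m \<in> int_vectors}"
    \<comment> \<open>Adding 1 makes the final estimate strict and covers
      \<open>v = 0\<close>.\<close>
    define \<delta> where "\<delta> = c / (norm v + 1)"
    have "\<delta> > 0" using c by (simp add: \<delta>_def add_nonneg_pos)
    then obtain k m where m: "m \<in> int_vectors" and d: "dist (((\<lambda>v. M *v v) ^^ k) x + m) yl < \<delta>"
      using cl unfolding closure_approachable by blast
    have "v \<bullet> m \<in> \<int>"
      using v m by (auto simp: inner_vec_def int_vectors_def intro!: Ints_sum Ints_mult)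
    then obtain l where l: "v \<bullet> m = of_int l" by (rule Ints_cases)
    have "c \<le> \<bar>v \<bullet> (((\<lambda>v. M *v v) ^^ k) x + m - yl)\<bar>"
      using away[of k "- l"] by (simp add: inner_diff_right inner_add_right l algebra_simps)
    also have "\<dots> \<le> norm v * norm (((\<lambda>v. M *v v) ^^ k) x + m - yl)" by (rule Cauchy_Schwarz_ineq2)
    also have "\<dots> \<le> norm v * \<delta>" using d by (intro mult_left_mono) (auto simp: dist_norm)
    also have "\<dots> < (norm v + 1) * \<delta>" using \<open>\<delta> > 0\<close> by simp
    also have "\<dots> = c" by (simp add: \<delta>_def add_nonneg_eq_0_iff)
    finally show False by simp
  qed
  then show ?thesis by (simp add: Etilde_def torus_closure_lift_def)
qed

lemma alpha_winning_mono:
  assumes "alpha_winning K \<alpha> S" "S \<subseteq> S'"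
  shows "alpha_winning K \<alpha> S'"
  using assms unfolding alpha_winning_def ab_winning_def by (meson subsetD)

theorem theorem1p2:
  fixes K :: "(real^'n) set"
  assumes "\<exists>\<mu>. abs_decaying \<mu> \<and> K = msupp \<mu>"
  shows "\<exists>\<alpha>. 0 < \<alpha> \<and> \<alpha> < 1 \<and>
           (\<forall>M yl. integer_matrix M \<and> det M \<noteq> 0 \<longrightarrow> alpha_winning K \<alpha> (Etilde M yl))"
proof -
  obtain \<mu> where \<mu>: "abs_decaying \<mu>" "K = msupp \<mu>" using assms by blast
  obtain \<alpha> \<rho>\<^sub>0 where \<alpha>: "0 < \<alpha>" "\<alpha> < 1" "0 < \<rho>\<^sub>0"
    and avoid: "\<And>(I :: (nat \<times> (real^'n)) set) (w :: nat \<times> (real^'n) \<Rightarrow> real) a d x \<rho>.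
      \<lbrakk>finite I; \<And>i. i \<in> I \<Longrightarrow> 0 \<le> w i; \<And>i. i \<in> I \<Longrightarrow> a i \<noteq> 0; x \<in> msupp \<mu>; 0 < \<rho>; \<rho> < \<rho>\<^sub>0\<rbrakk> \<Longrightarrow>
      \<exists>y\<in>msupp \<mu>. dist x y \<le> (1 - \<alpha>) * \<rho> \<and>
        (\<Sum>i | i \<in> I \<and> \<bar>a i \<bullet> y - d i\<bar> \<le> 2 * \<alpha> * \<rho> * norm (a i). w i) \<le> (\<Sum>i\<in>I. w i) / 4"
    using abs_decaying_avoid_hyperplanes[OF \<mu>(1)] by blast
  have "alpha_winning K \<alpha> (Etilde M yl)" if M: "integer_matrix M" "det M \<noteq> 0" for M yl
  proof -
    obtain v where v: "v \<in> int_vectors"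
      and lac: "lacunary_set (range (\<lambda>k. ((\<lambda>v. transpose M *v v) ^^ k) v))"
      by (rule integer_matrix_lacunary_orbit[OF M])
    \<comment> \<open>\<open>\<alpha>\<close> was fixed before \<open>M\<close> and
      \<open>yl\<close>: the matrix enters only through the lacunary set and the vector
      \<open>v\<close>, the torus point only through the shift
      \<open>s = v \<bullet> yl\<close>.\<close>
    have "alpha_winning K \<alpha> {x. \<exists>c>0. \<forall>t\<in>range (\<lambda>k. ((\<lambda>v. transpose M *v v) ^^ k) v).
        \<forall>m::int. c \<le> \<bar>t \<bullet> x - v \<bullet> yl - m\<bar>}"
      unfolding \<mu>(2) by (rule lacunary_set_winning[OF \<alpha> avoid lac])
    then show ?thesis
    proof (rule alpha_winning_mono)
      show "{x. \<exists>c>0. \<forall>t\<in>range (\<lambda>k. ((\<lambda>v. transpose M *v v) ^^ k) v).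
        \<forall>m::int. c \<le> \<bar>t \<bullet> x - v \<bullet> yl - m\<bar>} \<subseteq> Etilde M yl"
      proof
        fix x assume "x \<in> {x. \<exists>c>0. \<forall>t\<in>range (\<lambda>k. ((\<lambda>v. transpose M *v v) ^^ k) v).
          \<forall>m::int. c \<le> \<bar>t \<bullet> x - v \<bullet> yl - m\<bar>}"
        then obtain c where "c > 0"
          "\<And>k (m::int). c \<le> \<bar>((\<lambda>v. transpose M *v v) ^^ k) v \<bullet> x - v \<bullet> yl - m\<bar>"
          by blast
        then show "x \<in> Etilde M yl"
          unfolding inner_funpow_transpose by (rule Etilde_if_functional_bounded_away[OF v])
      qed
    qed
  qed
  then show ?thesis using \<alpha> by blast
qed

end
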